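(* Let $\mathbf{L}=\langle L,\leq\rangle$ be a complete lattice, $S$ an $L$-parameterization, and $C\colon L\to L$ a closure operator in $\mathbf{L}$. The following are equivalent: (1) $C$ is an $S$-closure operator in $\mathbf{L}$; (2) $f(C(a))\leq C(f(a))$ for all $a\in L$ and all $\langle f,h\rangle\in S$; (3) $C(h(a))\leq h(C(a))$ for all $a\in L$ and all $\langle f,h\rangle\in S$.
   Context: A closure operator in $\mathbf{L}$ is $C\colon L\to L$ that is extensive ($a\leq C(a)$), monotone ($a\leq b$ implies $C(a)\leq C(b)$) and idempotent ($C(C(a))=C(a)$). An isotone Galois connection in $\mathbf{L}$ is a pair $\langle f,h\rangle$ of maps $L\to L$ with $f(a)\leq b$ iff $a\leq h(b)$. An $L$-parameterization is a set $S$ of isotone Galois connections containing $\langle\mathrm{id},\mathrm{id}\rangle$. An $S$-closure operator is $C\colon L\to L$ with $a\leq C(a)$, $a\leq b$ implies $C(a)\leq C(b)$, and $C(h(C(a)))\leq h(C(a))$ for all $a,b\in L$ and $\langle f,h\rangle\in S$. *)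

theory Defs
  imports Main
begin

definition closure_operator :: "('a::complete_lattice \<Rightarrow> 'a) \<Rightarrow> bool" where
  "closure_operator C \<longleftrightarrow>
     (\<forall>a. a \<le> C a) \<and>
     (\<forall>a b. a \<le> b \<longrightarrow> C a \<le> C b) \<and>
     (\<forall>a. C (C a) = C a)"

definition isotone_galois_connection ::
    "('a::complete_lattice \<Rightarrow> 'a) \<Rightarrow> ('a \<Rightarrow> 'a) \<Rightarrow> bool" where
  "isotone_galois_connection f h \<longleftrightarrow> (\<forall>a b. f a \<le> b \<longleftrightarrow> a \<le> h b)"

definition L_parameterization ::
    "(('a::complete_lattice \<Rightarrow> 'a) \<times> ('a \<Rightarrow> 'a)) set \<Rightarrow> bool" where
  "L_parameterization S \<longleftrightarrow>
     (\<forall>(f, h) \<in> S. isotone_galois_connection f h) \<and> (id, id) \<in> S"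

definition S_closure_operator ::
    "(('a::complete_lattice \<Rightarrow> 'a) \<times> ('a \<Rightarrow> 'a)) set \<Rightarrow> ('a \<Rightarrow> 'a) \<Rightarrow> bool" where
  "S_closure_operator S C \<longleftrightarrow>
     (\<forall>a. a \<le> C a) \<and>
     (\<forall>a b. a \<le> b \<longrightarrow> C a \<le> C b) \<and>
     (\<forall>a. \<forall>(f, h) \<in> S. C (h (C a)) \<le> h (C a))"

end

theory Submission
  imports Defs
begin

text \<open>The set S only contributes a universal quantifier, so the equivalence is proved for one
  adjoint pair in \<open>closure_adjoint_equivalences\<close> and then carried over pairwise. For a
  fixed pair, (1) says that \<open>h\<close> sends \<open>C\<close>-closed elements to
  \<open>C\<close>-closed elements. Then \<open>h (C (f a))\<close> is a closed element above
  \<open>a\<close>, hence above \<open>C a\<close>, and transposing gives (2). From (2), the counit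
  \<open>f (h a) \<le> a\<close> and another transposition give (3). Finally (3) at the closed
  element \<open>C a\<close> is (1), by idempotence.\<close>

lemma closure_adjoint_equivalences:
  fixes C f h :: "'a::complete_lattice \<Rightarrow> 'a"
  assumes C: "closure_operator C" and fh: "isotone_galois_connection f h"
  shows "(\<forall>a. C (h (C a)) \<le> h (C a)) \<longleftrightarrow> (\<forall>a. f (C a) \<le> C (f a))" (is "?A \<longleftrightarrow> ?B")
    and "(\<forall>a. f (C a) \<le> C (f a)) \<longleftrightarrow> (\<forall>a. C (h a) \<le> h (C a))" (is "_ \<longleftrightarrow> ?D")
proof -
  have ext: "a \<le> C a" and mono: "a \<le> b \<Longrightarrow> C a \<le> C b" and idem: "C (C a) = C a" for a b
    using C by (auto simp: closure_operator_def)
  have adj: "f a \<le> b \<longleftrightarrow> a \<le> h b" for a b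
    using fh by (simp add: isotone_galois_connection_def)
  have AB: ?B if ?A
  proof
    fix a
    \<comment> \<open>The transpose of extensivity at \<open>f a\<close>.\<close>
    have "a \<le> h (C (f a))" using ext adj by blast
    then have "C a \<le> C (h (C (f a)))" by (rule mono)
    also have "\<dots> \<le> h (C (f a))" using that by blast
    finally show "f (C a) \<le> C (f a)" by (simp add: adj)
  qed
  have BD: ?D if ?B
  proof
    fix a
    have "f (C (h a)) \<le> C (f (h a))" using that by blast
    \<comment> \<open>The counit \<open>f (h a) \<le> a\<close> is the transpose of
      \<open>h a \<le> h a\<close>.\<close>
    also have "\<dots> \<le> C a" by (rule mono) (simp add: adj)
    finally show "C (h a) \<le> h (C a)" by (simp add: adj)
  qed
  have DA: ?A if ?D
    \<comment> \<open>Instantiate \<open>?D\<close> at \<open>C a\<close> and collapse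
      \<open>C (C a)\<close>.\<close>
    using that idem by metis
  show "?A \<longleftrightarrow> ?B" using AB BD DA by blast
  show "?B \<longleftrightarrow> ?D" using AB BD DA by blast
qed

theorem theorem38:
  fixes S :: "(('a::complete_lattice \<Rightarrow> 'a) \<times> ('a \<Rightarrow> 'a)) set"
    and C :: "'a \<Rightarrow> 'a"
  assumes "L_parameterization S"
    and "closure_operator C"
  shows "(S_closure_operator S C \<longleftrightarrow> (\<forall>a. \<forall>(f, h) \<in> S. f (C a) \<le> C (f a))) \<and>
         ((\<forall>a. \<forall>(f, h) \<in> S. f (C a) \<le> C (f a)) \<longleftrightarrow>
          (\<forall>a. \<forall>(f, h) \<in> S. C (h a) \<le> h (C a)))"
proof -
  have gal: "isotone_galois_connection f h" if "(f, h) \<in> S" for f h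
    using assms(1) that by (auto simp: L_parameterization_def)
  \<comment> \<open>All three conditions get the pair quantified outermost, so that congruence over
    S leaves one claim per pair.\<close>
  have S_iff: "S_closure_operator S C \<longleftrightarrow> (\<forall>(f, h) \<in> S. \<forall>a. C (h (C a)) \<le> h (C a))"
    using assms(2) by (auto simp: S_closure_operator_def closure_operator_def)
  have f_iff: "(\<forall>a. \<forall>(f, h) \<in> S. f (C a) \<le> C (f a)) \<longleftrightarrow>
      (\<forall>(f, h) \<in> S. \<forall>a. f (C a) \<le> C (f a))"
    by auto
  have h_iff: "(\<forall>a. \<forall>(f, h) \<in> S. C (h a) \<le> h (C a)) \<longleftrightarrow>
      (\<forall>(f, h) \<in> S. \<forall>a. C (h a) \<le> h (C a))"
    by auto
  note eqv = closure_adjoint_equivalences[OF assms(2) gal]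
  show ?thesis
    unfolding S_iff f_iff h_iff by (intro conjI ball_cong refl) (clarify, rule eqv, assumption)+
qed

end
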